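(* For every integer $n\ge 3$, the minimum defect in a $2$-coloring of the wheel $W_n$ is \[ D(W_n,2)=\frac{2\lceil n/3\rceil}{\lceil n/3\rceil+1}. \]
   Context: Graphs are finite and simple. For a graph $G$ and a positive integer $k$, a (fractional) $k$-coloring of $G$ is an assignment to every vertex $v$ of real numbers $f_1(v),\dots,f_k(v)\ge 0$ with $\sum_{j=1}^k f_j(v)=1$ ($f_j(v)$ is the usage of color $j$ at $v$). The defect of $v$ is $\mathrm{df}(v)=\sum_{w\in N(v)}\sum_{j=1}^k\min(f_j(v),f_j(w))$, where $N(v)$ is the set of neighbors of $v$. The defect of the coloring is $\max_v \mathrm{df}(v)$, and the minimum defect $D(G,k)$ is the minimum of this quantity over all $k$-colorings of $G$. The wheel $W_n$ is the graph obtained from a cycle on $n$ vertices by adding a new vertex and joining it to every vertex of the cycle (so $W_n$ has $n+1$ vertices). *)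

theory Defs
  imports Complex_Main
begin

type_synonym 'a graph = "'a set \<times> 'a set set"

definition verts :: "'a graph \<Rightarrow> 'a set" where
  "verts G = fst G"

definition edges :: "'a graph \<Rightarrow> 'a set set" where
  "edges G = snd G"

definition finite_simple_graph :: "'a graph \<Rightarrow> bool" where
  "finite_simple_graph G \<longleftrightarrow>
     finite (verts G) \<and> (\<forall>e\<in>edges G. e \<subseteq> verts G \<and> card e = 2)"

definition neighbors :: "'a graph \<Rightarrow> 'a \<Rightarrow> 'a set" where
  "neighbors G v = {w \<in> verts G. {v, w} \<in> edges G}"

(* f v j is the usage of color j at v; the colors are 1, ..., k.
   Values of f outside verts G and {1..k} are unconstrained and never used. *)
definition coloring :: "'a graph \<Rightarrow> nat \<Rightarrow> ('a \<Rightarrow> nat \<Rightarrow> real) \<Rightarrow> bool" where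
  "coloring G k f \<longleftrightarrow>
     (\<forall>v\<in>verts G. (\<forall>j\<in>{1..k}. 0 \<le> f v j) \<and> (\<Sum>j=1..k. f v j) = 1)"

definition vertex_defect :: "'a graph \<Rightarrow> nat \<Rightarrow> ('a \<Rightarrow> nat \<Rightarrow> real) \<Rightarrow> 'a \<Rightarrow> real" where
  "vertex_defect G k f v = (\<Sum>w\<in>neighbors G v. \<Sum>j=1..k. min (f v j) (f w j))"

definition defect :: "'a graph \<Rightarrow> nat \<Rightarrow> ('a \<Rightarrow> nat \<Rightarrow> real) \<Rightarrow> real" where
  "defect G k f = Max (vertex_defect G k f ` verts G)"

(* A minimum, not an infimum: LEAST on the reals yields a known value only when
   it is attained, so an equation min_defect G k = d with d given explicitly
   needs a k-coloring of defect d. *)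
definition min_defect :: "'a graph \<Rightarrow> nat \<Rightarrow> real" where
  "min_defect G k = (LEAST d. \<exists>f. coloring G k f \<and> d = defect G k f)"

(* The rim is the cycle on 0, ..., n - 1 and the hub is the vertex n; intended for n \<ge> 3. *)
definition wheel :: "nat \<Rightarrow> nat graph" where
  "wheel n = ({0..n}, {{i, (i + 1) mod n} |i. i < n} \<union> {{i, n} |i. i < n})"

lemma finite_simple_graph_wheel:
  assumes "n \<ge> 3"
  shows "finite_simple_graph (wheel n)"
proof -
  have "(i + 1) mod n \<noteq> i \<and> (i + 1) mod n \<le> n" if "i < n" for i
    using assms that by (cases "i + 1 = n") auto
  then show ?thesis
    by (auto simp: finite_simple_graph_def wheel_def verts_def edges_def card_2_iff)
qed

end

theory Submission
  imports Defs
begin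

text \<open>
  In a 2-coloring put \<open>x v = f v 1\<close>, so that \<open>f v 2 = 1 - x v\<close> and an edge \<open>v w\<close> contributes
  \<open>1 - \<bar>x v - x w\<bar>\<close> to the defects of its two ends. Write \<open>a\<close> for the value at the hub,
  \<open>s i = 1 - \<bar>a - x i\<bar>\<close> for the contribution of the \<open>i\<close>-th spoke, \<open>m = \<lceil>n/3\<rceil>\<close>, which is the
  domination number of the rim, and \<open>d = 2 - t\<close> for a bound on the defects.

  Lower bound. Let \<open>t \<ge> 0\<close>, since otherwise \<open>d > 2\<close> and nothing is to be shown. Exchanging
  the two colors if necessary, let \<open>a \<le> 1/2\<close>. The hub condition
  \<open>(\<Sum>i<n. s i) \<le> 2 - t\<close> forces \<open>s i \<ge> t\<close> at every rim vertex with \<open>x i < a\<close>. So for rim vertices in the complement of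
  \<open>A = {i. s i \<ge> t}\<close> we have \<open>x \<ge> a\<close>, and there distances between values of \<open>x\<close> are distances between
  values of \<open>s\<close>. Let \<open>U\<close> be the set of rim vertices that \<open>A\<close> does not dominate. At \<open>u \<in> U\<close> the
  defect condition says that \<open>s u\<close> is strictly smaller than the values of \<open>s\<close> at both rim neighbors,
  and that these two values add up to at least \<open>t\<close> (lemma \<open>small_triple\<close>). Strictness shows that no
  two vertices of \<open>U\<close> are adjacent, and hence that no two share a neighbor, since a common neighbor
  would be undominated too. So the rim neighbors of the vertices of \<open>U\<close> are all different and lie
  outside \<open>A\<close>, and charging \<open>t\<close> to each vertex of \<open>A\<close> and to each pair of neighbors of a vertex
  of \<open>U\<close> gives \<open>(\<Sum>i<n. s i) \<ge> t * card (A \<union> U)\<close>. As \<open>A \<union> U\<close> dominates the rim, this is at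
  least \<open>t * m\<close>, so \<open>t * m \<le> 2 - t\<close>, which is \<open>d \<ge> 2 * m / (m + 1)\<close>
  (lemma \<open>hub_weight_lower_bound\<close>).

  Upper bound. Put \<open>t = 2 / (m + 1)\<close> and choose a set of \<open>m\<close> rim vertices that is both
  dominating and independent. Let \<open>x\<close> be \<open>0\<close> at the hub, \<open>1 - t\<close> on the chosen set and \<open>1\<close> on the
  rest of the rim. The hub has defect \<open>m * t = 2 - t\<close>, a chosen vertex \<open>t + 2 * (1 - t) = 2 - t\<close>, and
  any other rim vertex at most \<open>1 + (1 - t) = 2 - t\<close>.
\<close>

section \<open>Cyclic neighbors on the rim\<close>

definition cyc_next :: "nat \<Rightarrow> nat \<Rightarrow> nat" where
  "cyc_next n i = (if Suc i = n then 0 else Suc i)"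

definition cyc_prev :: "nat \<Rightarrow> nat \<Rightarrow> nat" where
  "cyc_prev n i = (if i = 0 then n - 1 else i - 1)"

lemma cyc_next_less [simp]: "i < n \<Longrightarrow> cyc_next n i < n"
  and cyc_prev_less [simp]: "i < n \<Longrightarrow> cyc_prev n i < n"
  by (auto simp: cyc_next_def cyc_prev_def)

lemma cyc_next_prev [simp]: "i < n \<Longrightarrow> cyc_next n (cyc_prev n i) = i"
  and cyc_prev_next [simp]: "i < n \<Longrightarrow> cyc_prev n (cyc_next n i) = i"
  by (auto simp: cyc_next_def cyc_prev_def)

lemma cyc_next_eq_mod: "i < n \<Longrightarrow> (i + 1) mod n = cyc_next n i"
  by (auto simp: cyc_next_def)

lemma inj_on_cyc_next: "inj_on (cyc_next n) {..<n}"
  by (rule inj_on_inverseI[where g = "cyc_prev n"]) simp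

lemma inj_on_cyc_prev: "inj_on (cyc_prev n) {..<n}"
  by (rule inj_on_inverseI[where g = "cyc_next n"]) simp

lemma cyc_dominating_card:
  assumes "D \<subseteq> {..<n}"
    and dom: "\<And>i. i < n \<Longrightarrow> i \<in> D \<or> cyc_prev n i \<in> D \<or> cyc_next n i \<in> D"
  shows "real_of_int \<lceil>real n / 3\<rceil> \<le> real (card D)"
proof -
  have fin: "finite D" using assms(1) finite_subset by blast
  have "{..<n} \<subseteq> D \<union> (cyc_next n ` D \<union> cyc_prev n ` D)"
  proof
    fix i assume "i \<in> {..<n}"
    then have "i < n" by simp
    from dom[OF this] cyc_next_prev[OF this] cyc_prev_next[OF this]
    show "i \<in> D \<union> (cyc_next n ` D \<union> cyc_prev n ` D)" by (metis UnI1 UnI2 imageI)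
  qed
  then have "card {..<n} \<le> card (D \<union> (cyc_next n ` D \<union> cyc_prev n ` D))"
    using fin by (intro card_mono) auto
  also have "\<dots> \<le> card D + (card (cyc_next n ` D) + card (cyc_prev n ` D))"
    by (meson add_left_mono card_Un_le order_trans)
  also have "\<dots> \<le> 3 * card D"
    using card_image_le[OF fin, of "cyc_next n"] card_image_le[OF fin, of "cyc_prev n"] by simp
  finally have "real n / 3 \<le> real (card D)" by simp
  then have "\<lceil>real n / 3\<rceil> \<le> int (card D)" by (simp add: ceiling_le_iff)
  then show ?thesis by linarith
qed

section \<open>Defects in the wheel\<close>

lemma neighbors_hub: "neighbors (wheel n) n = {..<n}"
  by (auto simp: neighbors_def wheel_def verts_def edges_def doubleton_eq_iff)

lemma neighbors_rim:
  assumes "i < n"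
  shows "neighbors (wheel n) i = {cyc_prev n i, cyc_next n i, n}"
proof -
  have rim_edges: "{{j, (j + 1) mod n} |j. j < n} = {{j, cyc_next n j} |j. j < n}"
    by (metis cyc_next_eq_mod)
  have "w \<in> neighbors (wheel n) i \<longleftrightarrow> w = cyc_prev n i \<or> w = cyc_next n i \<or> w = n" for w
  proof
    assume "w \<in> neighbors (wheel n) i"
    then have "(\<exists>j<n. {i, w} = {j, cyc_next n j}) \<or> (\<exists>j<n. {i, w} = {j, n})"
      unfolding neighbors_def wheel_def verts_def edges_def rim_edges by auto
    then show "w = cyc_prev n i \<or> w = cyc_next n i \<or> w = n"
      using assms by (auto simp: doubleton_eq_iff)
  next
    assume w: "w = cyc_prev n i \<or> w = cyc_next n i \<or> w = n"
    have "{i, cyc_prev n i} = {cyc_prev n i, cyc_next n (cyc_prev n i)}"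
      using assms by auto
    then have "(\<exists>j<n. {i, w} = {j, cyc_next n j}) \<or> (\<exists>j<n. {i, w} = {j, n})"
      using w assms cyc_prev_less[OF assms] by metis
    moreover have "w \<le> n"
      using w cyc_prev_less[OF assms] cyc_next_less[OF assms] by auto
    ultimately show "w \<in> neighbors (wheel n) i"
      unfolding neighbors_def wheel_def verts_def edges_def rim_edges by auto
  qed
  then show ?thesis by blast
qed

lemma coloring_2_iff:
  "coloring G 2 f \<longleftrightarrow> (\<forall>v\<in>verts G. 0 \<le> f v 1 \<and> f v 1 \<le> 1 \<and> f v 2 = 1 - f v 1)"
proof -
  have "{1..2::nat} = {1, 2}" by auto
  then show ?thesis by (auto simp: coloring_def)
qed

lemma vertex_defect_2:
  assumes "coloring G 2 f" "v \<in> verts G"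
  shows "vertex_defect G 2 f v = (\<Sum>w\<in>neighbors G v. 1 - \<bar>f v 1 - f w 1\<bar>)"
  unfolding vertex_defect_def
proof (rule sum.cong)
  fix w assume "w \<in> neighbors G v"
  then have "w \<in> verts G" by (simp add: neighbors_def)
  with assms have "f v 2 = 1 - f v 1" "f w 2 = 1 - f w 1" by (auto simp: coloring_2_iff)
  moreover have "{1..2::nat} = {1, 2}" by auto
  ultimately show "(\<Sum>j=1..2. min (f v j) (f w j)) = 1 - \<bar>f v 1 - f w 1\<bar>" by simp
qed simp

lemma verts_wheel: "verts (wheel n) = {0..n}"
  by (simp add: wheel_def verts_def)

lemma hub_defect:
  assumes "coloring (wheel n) 2 f"
  shows "vertex_defect (wheel n) 2 f n = (\<Sum>i<n. 1 - \<bar>f n 1 - f i 1\<bar>)"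
  using assms by (simp add: vertex_defect_2 verts_wheel neighbors_hub)

lemma rim_defect:
  assumes "coloring (wheel n) 2 f" "n \<ge> 3" "i < n"
  shows "vertex_defect (wheel n) 2 f i =
    (1 - \<bar>f n 1 - f i 1\<bar>) + (1 - \<bar>f i 1 - f (cyc_prev n i) 1\<bar>) + (1 - \<bar>f i 1 - f (cyc_next n i) 1\<bar>)"
proof -
  have "cyc_prev n i \<noteq> cyc_next n i" "cyc_prev n i \<noteq> n" "cyc_next n i \<noteq> n"
    using assms by (auto simp: cyc_prev_def cyc_next_def)
  then show ?thesis
    using assms by (simp add: vertex_defect_2 verts_wheel neighbors_rim abs_minus_commute)
qed

lemma defect_le_iff:
  "defect (wheel n) k f \<le> d \<longleftrightarrow>
     vertex_defect (wheel n) k f n \<le> d \<and> (\<forall>i<n. vertex_defect (wheel n) k f i \<le> d)"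
proof -
  have "{0..n} = insert n {..<n}" by auto
  then show ?thesis by (auto simp: defect_def verts_wheel)
qed

section \<open>Lower bound\<close>

text \<open>
  Here \<open>p\<close>, \<open>q\<close> and \<open>r\<close> are the spoke contributions at a rim vertex and at its two rim neighbors.
  If \<open>q \<le> p\<close>, then \<open>\<bar>p - q\<bar> - p = - q\<close> and the hypothesis would give \<open>t \<le> \<bar>p - r\<bar>\<close>, which is
  impossible in \<open>[0, t)\<close>; the same holds for \<open>r\<close>.
\<close>

lemma small_triple:
  fixes p q r t :: real
  assumes "p \<in> {0..<t}" "q \<in> {0..<t}" "r \<in> {0..<t}"
    and "t \<le> \<bar>p - q\<bar> + \<bar>p - r\<bar> - p"
  shows "p < q" and "p < r" and "t \<le> q + r"
  using assms by (auto simp: abs_if split: if_splits)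

text \<open>
  The charging argument, in terms of the spoke contributions alone. The hypothesis is only about
  vertices whose closed rim neighborhood has contributions below \<open>t\<close>; this is where a contribution
  determines the color of the vertex.
\<close>

lemma charging_bound:
  fixes s :: "nat \<Rightarrow> real"
  assumes "t \<ge> 0" and nonneg: "\<And>i. i < n \<Longrightarrow> 0 \<le> s i"
    and triple: "\<And>i. \<lbrakk>i < n; s i < t; s (cyc_prev n i) < t; s (cyc_next n i) < t\<rbrakk> \<Longrightarrow>
      t \<le> \<bar>s i - s (cyc_prev n i)\<bar> + \<bar>s i - s (cyc_next n i)\<bar> - s i"
  shows "t * real_of_int \<lceil>real n / 3\<rceil> \<le> (\<Sum>i<n. s i)"
proof -
  define A where "A = {i. i < n \<and> t \<le> s i}"
  define U where "U = {i. i < n \<and> s i < t \<and> s (cyc_prev n i) < t \<and> s (cyc_next n i) < t}"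
  let ?P = "cyc_prev n ` U" and ?N = "cyc_next n ` U"
  have sub: "A \<subseteq> {..<n}" "U \<subseteq> {..<n}" "?P \<subseteq> {..<n}" "?N \<subseteq> {..<n}"
    by (auto simp: A_def U_def)
  then have fin: "finite A" "finite U" "finite ?P" "finite ?N"
    by (meson finite_lessThan finite_subset)+
  have U: "s i < s (cyc_prev n i)" "s i < s (cyc_next n i)"
    "t \<le> s (cyc_prev n i) + s (cyc_next n i)" if "i \<in> U" for i
    using small_triple[of "s i" t "s (cyc_prev n i)" "s (cyc_next n i)"] triple[of i] nonneg that
    by (auto simp: U_def)
  have disj_PN: "?P \<inter> ?N = {}"
  proof (rule ccontr)
    assume "?P \<inter> ?N \<noteq> {}"
    then obtain u u' where u: "u \<in> U" "u' \<in> U" "cyc_prev n u = cyc_next n u'" by auto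
    define v where "v = cyc_prev n u"
    have "u < n" "u' < n" using u sub(2) by auto
    then have v: "v < n" "cyc_next n v = u" "cyc_prev n v = u'"
      unfolding v_def by (simp, simp, simp only: u(3) cyc_prev_next)
    \<comment> \<open>A common neighbor of two vertices of \<open>U\<close> is not dominated by \<open>A\<close>, so it is itself in \<open>U\<close>.\<close>
    have "s v < t" using u(1) by (simp add: U_def v_def)
    then have "v \<in> U" using u(1,2) v by (simp add: U_def)
    then show False using U(2)[of v] U(1)[OF u(1)] unfolding v(2) v_def[symmetric] by simp
  qed
  have "real_of_int \<lceil>real n / 3\<rceil> \<le> real (card (A \<union> U))"
  proof (rule cyc_dominating_card)
    fix i assume "i < n"
    then show "i \<in> A \<union> U \<or> cyc_prev n i \<in> A \<union> U \<or> cyc_next n i \<in> A \<union> U"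
      by (auto simp: A_def U_def not_less)
  qed (use sub in auto)
  also have "\<dots> = real (card A) + real (card U)"
    using fin by (subst card_Un_disjoint) (auto simp: A_def U_def)
  finally have "t * real_of_int \<lceil>real n / 3\<rceil> \<le> t * (real (card A) + real (card U))"
    using \<open>t \<ge> 0\<close> by (rule mult_left_mono)
  also have "\<dots> = (\<Sum>i\<in>A. t) + (\<Sum>i\<in>U. t)" by (simp add: algebra_simps)
  also have "\<dots> \<le> sum s A + (\<Sum>i\<in>U. s (cyc_prev n i) + s (cyc_next n i))"
    using U(3) by (intro add_mono sum_mono) (auto simp: A_def)
  also have "\<dots> = sum s A + (sum s ?P + sum s ?N)"
    using inj_on_subset[OF inj_on_cyc_prev sub(2)] inj_on_subset[OF inj_on_cyc_next sub(2)]
    by (simp add: sum.reindex sum.distrib)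
  also have "\<dots> = sum s A + sum s (?P \<union> ?N)"
    using fin disj_PN by (simp add: sum.union_disjoint)
  also have "\<dots> = sum s (A \<union> (?P \<union> ?N))"
    using fin by (subst sum.union_disjoint) (auto simp: A_def U_def)
  also have "\<dots> \<le> (\<Sum>i<n. s i)"
    using sub nonneg by (intro sum_mono2) auto
  finally show ?thesis .
qed

text \<open>
  All spokes contribute at least \<open>a\<close>, and a spoke to a vertex with \<open>x i < a\<close> at least \<open>1 - a\<close>. If
  there is such a vertex, the hub condition reads \<open>1 - a + (n - 1) * a \<le> 2 - t\<close>, so
  \<open>(n - 2) * a \<le> 1 - t\<close>. Since \<open>n \<ge> 3\<close> this gives \<open>a \<le> 1 - t\<close>, so that spoke contributes at
  least \<open>t\<close>.
\<close>

lemma below_hub_contribution: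
  fixes x :: "nat \<Rightarrow> real"
  assumes "n \<ge> 3" "0 \<le> a" "a \<le> 1 / 2"
    and x: "\<And>i. i < n \<Longrightarrow> 0 \<le> x i \<and> x i \<le> 1"
    and hub: "(\<Sum>i<n. 1 - \<bar>a - x i\<bar>) \<le> 2 - t"
    and "i < n" "x i < a"
  shows "t \<le> 1 - \<bar>a - x i\<bar>"
proof -
  have "real (n - 1) * a = (\<Sum>j\<in>{..<n} - {i}. a)"
    using \<open>i < n\<close> by (simp add: card_Diff_singleton)
  also have "\<dots> \<le> (\<Sum>j\<in>{..<n} - {i}. 1 - \<bar>a - x j\<bar>)"
  proof (rule sum_mono)
    fix j assume "j \<in> {..<n} - {i}"
    then have "0 \<le> x j \<and> x j \<le> 1" using x by simp
    then show "a \<le> 1 - \<bar>a - x j\<bar>" using assms(2,3) by (simp add: abs_if)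
  qed
  also have "\<dots> = (\<Sum>j<n. 1 - \<bar>a - x j\<bar>) - (1 - \<bar>a - x i\<bar>)"
    using \<open>i < n\<close> by (simp add: sum_diff1)
  finally have "real (n - 1) * a \<le> 2 - t - (1 - \<bar>a - x i\<bar>)" using hub by linarith
  moreover have "2 * a \<le> real (n - 1) * a"
    using assms(1,2) by (intro mult_right_mono) auto
  moreover have "\<bar>a - x i\<bar> = a - x i" "0 \<le> x i"
    using x[OF \<open>i < n\<close>] \<open>x i < a\<close> by auto
  ultimately show ?thesis by linarith
qed

lemma hub_weight_lower_bound:
  fixes x :: "nat \<Rightarrow> real"
  assumes "n \<ge> 3" "0 \<le> a" "a \<le> 1 / 2" "t \<ge> 0"
    and x: "\<And>i. i < n \<Longrightarrow> 0 \<le> x i \<and> x i \<le> 1"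
    and hub: "(\<Sum>i<n. 1 - \<bar>a - x i\<bar>) \<le> 2 - t"
    and rim: "\<And>i. i < n \<Longrightarrow> (1 - \<bar>a - x i\<bar>) + (1 - \<bar>x i - x (cyc_prev n i)\<bar>)
        + (1 - \<bar>x i - x (cyc_next n i)\<bar>) \<le> 2 - t"
  shows "t * real_of_int \<lceil>real n / 3\<rceil> \<le> 2 - t"
proof -
  define s where "s i = 1 - \<bar>a - x i\<bar>" for i
  have above: "s i = 1 - (x i - a)" if "i < n" "s i < t" for i
    using below_hub_contribution[OF assms(1-3) x hub that(1)] that unfolding s_def by force
  have "t * real_of_int \<lceil>real n / 3\<rceil> \<le> (\<Sum>i<n. s i)"
  proof (rule charging_bound)
    show "0 \<le> s i" if "i < n" for i
      using x[OF that] assms(2,3) by (auto simp: s_def abs_if)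
    fix i assume i: "i < n" "s i < t" "s (cyc_prev n i) < t" "s (cyc_next n i) < t"
    then have "s i = 1 - (x i - a)" "s (cyc_prev n i) = 1 - (x (cyc_prev n i) - a)"
      "s (cyc_next n i) = 1 - (x (cyc_next n i) - a)"
      using above[of i] above[of "cyc_prev n i"] above[of "cyc_next n i"] by simp_all
    then have "\<bar>s i - s (cyc_prev n i)\<bar> = \<bar>x i - x (cyc_prev n i)\<bar>"
      "\<bar>s i - s (cyc_next n i)\<bar> = \<bar>x i - x (cyc_next n i)\<bar>"
      by (simp_all add: abs_minus_commute)
    with rim[OF i(1)] show "t \<le> \<bar>s i - s (cyc_prev n i)\<bar> + \<bar>s i - s (cyc_next n i)\<bar> - s i"
      by (simp add: s_def)
  qed (fact \<open>t \<ge> 0\<close>)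
  then show ?thesis using hub by (simp add: s_def)
qed

lemma defect_wheel_ge:
  assumes "n \<ge> 3" and f: "coloring (wheel n) 2 f"
  shows "2 * real_of_int \<lceil>real n / 3\<rceil> / (real_of_int \<lceil>real n / 3\<rceil> + 1) \<le> defect (wheel n) 2 f"
proof -
  define m where "m = real_of_int \<lceil>real n / 3\<rceil>"
  define t where "t = 2 - defect (wheel n) 2 f"
  define a where "a = f n 1"
  define x where "x i = f i 1" for i
  have "m \<ge> 0" by (simp add: m_def)
  have bounds: "0 \<le> a" "a \<le> 1" and x: "\<And>i. i < n \<Longrightarrow> 0 \<le> x i \<and> x i \<le> 1"
    using f by (auto simp: coloring_2_iff verts_wheel a_def x_def)
  have "defect (wheel n) 2 f \<le> 2 - t" by (simp add: t_def)
  then have hub: "(\<Sum>i<n. 1 - \<bar>a - x i\<bar>) \<le> 2 - t"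
    and rim: "\<And>i. i < n \<Longrightarrow> (1 - \<bar>a - x i\<bar>) + (1 - \<bar>x i - x (cyc_prev n i)\<bar>)
        + (1 - \<bar>x i - x (cyc_next n i)\<bar>) \<le> 2 - t"
    using assms by (simp_all add: defect_le_iff hub_defect rim_defect a_def x_def)
  have "t * m \<le> 2 - t"
  proof (cases "t \<ge> 0")
    case True
    show ?thesis
    proof (cases "a \<le> 1 / 2")
      case a: True
      show ?thesis
        unfolding m_def by (rule hub_weight_lower_bound[OF assms(1) bounds(1) a True x hub rim])
    next
      case False
      have flip: "\<bar>(1 - p) - (1 - q)\<bar> = \<bar>p - q\<bar>" for p q :: real by simp
      show ?thesis
        unfolding m_def
        by (rule hub_weight_lower_bound[where a = "1 - a" and x = "\<lambda>i. 1 - x i"])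
          (use assms(1) False True bounds x hub rim in \<open>simp_all only: flip\<close>, auto)
    qed
  next
    case False
    then have "t * m \<le> 0" using \<open>m \<ge> 0\<close> by (simp add: mult_nonpos_nonneg)
    then show ?thesis using False by simp
  qed
  then have "2 * m \<le> defect (wheel n) 2 f * (m + 1)" by (simp add: t_def algebra_simps)
  then show ?thesis using \<open>m \<ge> 0\<close> unfolding m_def[symmetric] by (simp add: divide_le_eq)
qed

section \<open>An optimal coloring\<close>

text \<open>
  Every third rim vertex, starting from \<open>1\<close>. This leaves the last vertex undominated exactly when
  \<open>n mod 3 = 1\<close>. Adding it then keeps the set independent, because neither \<open>0\<close> nor \<open>n - 2\<close>, which
  is \<open>2\<close> modulo \<open>3\<close>, is chosen.
\<close>

definition rim_dominators :: "nat \<Rightarrow> nat set" where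
  "rim_dominators n = {i. i < n \<and> (i mod 3 = 1 \<or> n mod 3 = 1 \<and> Suc i = n)}"

lemma card_rim_dominators:
  assumes "n \<ge> 3"
  shows "real (card (rim_dominators n)) \<le> real_of_int \<lceil>real n / 3\<rceil>"
proof -
  define k where "k = (n + 2) div 3"
  have "rim_dominators n \<subseteq> (\<lambda>j. min (3 * j + 1) (n - 1)) ` {..<k}"
  proof
    fix i assume "i \<in> rim_dominators n"
    then have "i = min (3 * (i div 3) + 1) (n - 1)" "i div 3 < k"
      unfolding rim_dominators_def k_def min_def using assms by (auto; presburger)+
    then show "i \<in> (\<lambda>j. min (3 * j + 1) (n - 1)) ` {..<k}" by blast
  qed
  then have "card (rim_dominators n) \<le> k"
    using surj_card_le[OF finite_lessThan] by fastforce
  moreover have "int k \<le> \<lceil>real n / 3\<rceil>"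
  proof -
    have "3 * k < n + 3" unfolding k_def by presburger
    then show ?thesis by (simp add: le_ceiling_iff field_simps)
  qed
  ultimately show ?thesis by linarith
qed

lemma rim_dominators_independent:
  assumes "n \<ge> 3" "i \<in> rim_dominators n"
  shows "cyc_next n i \<notin> rim_dominators n" "cyc_prev n i \<notin> rim_dominators n"
proof -
  have next_notin: "cyc_next n j \<notin> rim_dominators n" if "j \<in> rim_dominators n" for j
  proof (cases "Suc j = n")
    case True
    then show ?thesis using assms(1) by (simp add: cyc_next_def rim_dominators_def)
  next
    case False
    then have "j mod 3 = 1" using that by (simp add: rim_dominators_def)
    then have "Suc j mod 3 = 2" "Suc (Suc j) mod 3 = 0" by (simp_all add: mod_Suc)
    then show ?thesis using False by (auto simp: cyc_next_def rim_dominators_def)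
  qed
  then show "cyc_next n i \<notin> rim_dominators n" using assms(2) .
  have "i < n" using assms(2) by (simp add: rim_dominators_def)
  then show "cyc_prev n i \<notin> rim_dominators n"
    using next_notin[of "cyc_prev n i"] assms(2) by auto
qed

lemma rim_dominators_dominating:
  assumes "i < n" "i \<notin> rim_dominators n"
  shows "cyc_prev n i \<in> rim_dominators n \<or> cyc_next n i \<in> rim_dominators n"
proof (cases "i mod 3 = 0")
  case True
  then have "Suc i mod 3 = 1" by (simp add: mod_Suc)
  moreover from this have "Suc i \<noteq> n" using assms by (auto simp: rim_dominators_def)
  ultimately show ?thesis using assms(1) by (simp add: cyc_next_def rim_dominators_def)
next
  case False
  then obtain j where j: "i = Suc j" by (cases i) auto
  moreover have "Suc j mod 3 \<noteq> 1" using assms j by (simp add: rim_dominators_def)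
  ultimately have "j mod 3 = 1" using False by (auto simp: mod_Suc split: if_splits)
  then show ?thesis using assms(1) j by (simp add: cyc_prev_def rim_dominators_def)
qed

lemma optimal_coloring_exists:
  assumes "n \<ge> 3"
  shows "\<exists>f. coloring (wheel n) 2 f \<and>
    defect (wheel n) 2 f \<le> 2 * real_of_int \<lceil>real n / 3\<rceil> / (real_of_int \<lceil>real n / 3\<rceil> + 1)"
proof -
  define m where "m = real_of_int \<lceil>real n / 3\<rceil>"
  define t where "t = 2 / (m + 1)"
  define D where "D = rim_dominators n"
  define x where "x v = (if v = n then 0 else if v \<in> D then 1 - t else 1)" for v
  define f :: "nat \<Rightarrow> nat \<Rightarrow> real" where "f v j = (if j = 1 then x v else 1 - x v)" for v j
  have "m \<ge> 1" using assms by (simp add: m_def)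
  then have t: "0 < t" "t \<le> 1" and tm: "t * m = 2 - t" by (auto simp: t_def field_simps)
  have col: "coloring (wheel n) 2 f"
    using t by (auto simp: coloring_2_iff f_def x_def)
  have hub: "vertex_defect (wheel n) 2 f n \<le> 2 - t"
  proof -
    have "vertex_defect (wheel n) 2 f n = (\<Sum>i<n. if i \<in> D then t else 0)"
      unfolding hub_defect[OF col] using t by (intro sum.cong) (auto simp: f_def x_def)
    also have "\<dots> = (\<Sum>i\<in>{..<n} \<inter> D. t)" by (subst sum.inter_restrict) auto
    also have "{..<n} \<inter> D = D" by (auto simp: D_def rim_dominators_def)
    also have "(\<Sum>i\<in>D. t) = t * real (card D)" by simp
    also have "\<dots> \<le> t * m"
      using card_rim_dominators[OF assms] t by (intro mult_left_mono) (auto simp: D_def m_def)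
    finally show ?thesis by (simp add: tm)
  qed
  have rim: "vertex_defect (wheel n) 2 f i \<le> 2 - t" if "i < n" for i
  proof -
    have "i \<noteq> n" "cyc_prev n i \<noteq> n" "cyc_next n i \<noteq> n"
      using that cyc_prev_less[OF that] cyc_next_less[OF that]
      by (auto simp del: cyc_prev_less cyc_next_less)
    then show ?thesis
      using rim_dominators_independent[OF assms, of i] rim_dominators_dominating[OF that] t
      unfolding rim_defect[OF col assms that] D_def[symmetric]
      by (cases "i \<in> D") (auto simp: f_def x_def)
  qed
  have "2 - t = 2 * m / (m + 1)" using \<open>m \<ge> 1\<close> by (simp add: t_def field_simps)
  then have "defect (wheel n) 2 f \<le> 2 * m / (m + 1)"
    using hub rim by (auto simp: defect_le_iff)
  then show ?thesis using col unfolding m_def by blast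
qed

section \<open>The minimum defect\<close>

theorem proposition3:
  fixes n :: nat
  assumes "n \<ge> 3"
  shows "min_defect (wheel n) 2 = 2 * real_of_int \<lceil>real n / 3\<rceil> / (real_of_int \<lceil>real n / 3\<rceil> + 1)"
  unfolding min_defect_def
proof (rule Least_equality)
  show "\<exists>f. coloring (wheel n) 2 f \<and>
      2 * real_of_int \<lceil>real n / 3\<rceil> / (real_of_int \<lceil>real n / 3\<rceil> + 1) = defect (wheel n) 2 f"
    using optimal_coloring_exists[OF assms] defect_wheel_ge[OF assms] by (meson order_antisym)
qed (use defect_wheel_ge[OF assms] in auto)

end
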